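(* Let $T$ be a decidable, stably infinite $\Sigma$-theory with $\Sigma$ disjoint from the signature of $\mathcal Z$. Then $\mathrm{BC}(T)$ is a complete optimization procedure for the ILP Modulo $T$ problem: for every ILP Modulo $T$ instance $(C, I, O)$ there is a finite sequence of $\mathrm{BC}(T)$ transitions from the starting state $\langle \{\langle C, \emptyset\rangle\}, \mathrm{none}\rangle$ to a final state $\langle \emptyset, A\rangle$ (where $A$ is $\mathrm{none}$, an assignment, or an assignment annotated with $-\infty$).
   Context: Fix a set $\mathcal V$ of integer variables. An integer linear constraint has the form $c_1v_1+\dots+c_nv_n \bowtie r$ with integers $c_i, r$, $v_i \in \mathcal V$, $\bowtie \in \{<,\le,=,>,\ge\}$; an integer linear formula is a finite set (conjunction) of such constraints. An integer assignment is a function $A:\mathcal V\to\mathbb Z$, identified with the set of formulas $\{v = A(v) : v\in\mathcal V\}$. $\mathcal Z$ denotes the theory of linear integer arithmetic (all first-order sentences over the signature $0,\pm1,\pm2,\dots,+,-,\le$ true in the standard model $\mathbb Z$). For a theory $T'$, a formula $F$ is $T'$-consistent if $F\wedge T'$ has a model, and $F\models_{T'} G$ means $F\wedge\neg G$ is $T'$-inconsistent. A $\Sigma$-theory $T$ is stably infinite if every $T$-satisfiable quantifier-free $\Sigma$-formula is satisfied together with $T$ by some interpretation with infinite domain; it is decidable if $T$-satisfiability of quantifier-free $\Sigma$-formulas is decidable. A $\Sigma$-interface atom is a $\Sigma$-atomic formula $t$, possibly annotated with a variable $v$ (written $t^v$), the annotation meaning $t \Leftrightarrow v>0$. An ILP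 Modulo $T$ instance is a triple $(C, I, O)$ with $C$ an integer linear formula, $I$ a set of $\Sigma$-interface atoms, and $O=\sum_i c_i v_i$ an integer linear expression to be minimized. For an assignment $A$, $obj(A)=\sum_i c_iA(v_i)$; also $obj(\mathrm{none})=+\infty$ and $obj(A^{-\infty})=-\infty$. An assignment $A$ is a $T$-model of a formula $F$ if $A$ is $T$-consistent and $A\models_{\mathcal Z\cup T} F$. A simple equality is a constraint $v_i=c$ or $v_i-v_j=c$ ($c$ an integer constant). A subproblem is a pair $\langle C, D\rangle$ with $C$ a set of integer linear constraints and $D$ a set of simple equalities. A state is a pair $\langle P, A\rangle$ where $P$ is a set of subproblems and $A$ is either the constant $\mathrm{none}$, an assignment, or an assignment annotated with superscript $-\infty$. A fixed function $lb$ on subproblems satisfies: no assignment $A$ satisfying $C\wedge D$ has $obj(A) < lb(\langle C,D\rangle)$. Notation: $P\uplus Q$ is union of disjoint sets; $C\,c$ is $C\cup\{c\}$ with $c\notin C$ (likewise $D\,d$). The transition relation $\longrightarrow$ of $\mathrm{BC}(T)$ is given by the rules: Branch: $\langle P\uplus\{\langle C,D\rangle\}, A\rangle \longrightarrow \langle P\cup\{\langle C_i,D\rangle : 1\le i\le n\}, A\rangle$ if $n>1$, $D\models_{\mathcal Z}(C\Leftrightarrow\bigvee_{i} C_i)$, and the $C_i$ are syntactically distinct. Learn: $\langle P\uplus\{\langle C,D\rangle\},A\rangle\longrightarrow\langle P\cup\{\langle C\,c,D\rangle\},A\rangle$ if $C\wedge D\models_{\mathcal Z} c$. Forget: $\langle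 P\uplus\{\langle C\,c,D\rangle\},A\rangle\longrightarrow\langle P\cup\{\langle C,D\rangle\},A\rangle$ if $C\wedge D\models_{\mathcal Z} c$. Propagate: $\langle P\uplus\{\langle C,D\rangle\},A\rangle\longrightarrow\langle P\cup\{\langle C,D\,d\rangle\},A\rangle$ if $d$ is a simple equality and $C\wedge D\models_{\mathcal Z} d$. Drop: $\langle P\uplus\{\langle C,D\rangle\},A\rangle\longrightarrow\langle P,A\rangle$ if $C\wedge D$ has no integer solution. Prune: $\langle P\uplus\{\langle C,D\rangle\},A\rangle\longrightarrow\langle P,A\rangle$ if $A\neq\mathrm{none}$ and $lb(\langle C,D\rangle)\ge obj(A)$. Retire: $\langle P\uplus\{\langle C,D\rangle\},A\rangle\longrightarrow\langle P,A'\rangle$ if $A'$ is a $T$-model of $C\wedge D\wedge I$, $obj(A')<obj(A)$, and $obj(A')\le obj(B)$ for every $T$-model $B$ of $C\wedge D\wedge I$. Unbounded: $\langle P\uplus\{\langle C,D\rangle\},A\rangle\longrightarrow\langle \emptyset,A'^{-\infty}\rangle$ if $A'$ is a $T$-model of $C\wedge D\wedge I$, $obj(A')\le obj(A)$, and for every $k$ there is a $T$-model $B$ of $C\wedge D\wedge I$ with $obj(B)<k$. T-Learn: $\langle P\uplus\{\langle C,D\rangle\},A\rangle\longrightarrow\langle P\cup\{\langle C\,c,D\rangle\},A\rangle$ if there is a formula $F$ with $C\wedge D\models_{\mathcal Z} F$ and $F\wedge I\models_T c$. The starting state for instance $(C,I,O)$ is $\langle\{\langle C,\emptyset\rangle\},\mathrm{none}\rangle$;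 a final state is one of the form $\langle\emptyset, A\rangle$.
   Formalization: T-model of C∧D∧I here means: A together with I is consistent with Z∪T and A entails C∧D (literally entailing I fails, e.g. T empty, I={P(x)}). I is taken finite, V nonempty, and models have countable domains (equivalent by Löwenheim–Skolem). *)

theory Defs
  imports "HOL-Library.Extended_Real" "HOL-Library.Nat_Bijection"
begin

section \<open>First-order logic with equality\<close>

text \<open>One stock of symbols contains those of linear integer arithmetic and, for every name and
  arity, further function and predicate symbols. A signature is a selection from it.\<close>

datatype fsym = Num int | Plus | Minus | Fn (fn_name: nat) (fn_arity: nat)
datatype psym = Leq | Pr (pr_name: nat) (pr_arity: nat)

fun farity :: "fsym \<Rightarrow> nat" where
  "farity (Num i) = 0"
| "farity Plus = 2"
| "farity Minus = 2"
| "farity (Fn f k) = k"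

fun parity :: "psym \<Rightarrow> nat" where
  "parity Leq = 2"
| "parity (Pr p k) = k"

record signature =
  funs :: "fsym set"
  preds :: "psym set"

definition sig_disjoint :: "signature \<Rightarrow> signature \<Rightarrow> bool" where
  "sig_disjoint S S' \<longleftrightarrow> funs S \<inter> funs S' = {} \<and> preds S \<inter> preds S' = {}"

definition sig_union :: "signature \<Rightarrow> signature \<Rightarrow> signature" where
  "sig_union S S' = \<lparr>funs = funs S \<union> funs S', preds = preds S \<union> preds S'\<rparr>"

datatype 'v trm = Var 'v | App fsym "'v trm list"
datatype 'v atom = Equal "'v trm" "'v trm" | Pred psym "'v trm list"
datatype 'v form = Atom "'v atom" | Neg "'v form" | And "'v form" "'v form" | All 'v "'v form"

definition Iff :: "'v form \<Rightarrow> 'v form \<Rightarrow> 'v form" where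
  "Iff F G = And (Neg (And F (Neg G))) (Neg (And G (Neg F)))"

fun wf_trm :: "signature \<Rightarrow> 'v trm \<Rightarrow> bool" where
  "wf_trm S (Var x) \<longleftrightarrow> True"
| "wf_trm S (App f ts) \<longleftrightarrow> f \<in> funs S \<and> length ts = farity f \<and> (\<forall>t\<in>set ts. wf_trm S t)"

fun wf_atom :: "signature \<Rightarrow> 'v atom \<Rightarrow> bool" where
  "wf_atom S (Equal s t) \<longleftrightarrow> wf_trm S s \<and> wf_trm S t"
| "wf_atom S (Pred p ts) \<longleftrightarrow> p \<in> preds S \<and> length ts = parity p \<and> (\<forall>t\<in>set ts. wf_trm S t)"

fun wf_form :: "signature \<Rightarrow> 'v form \<Rightarrow> bool" where
  "wf_form S (Atom a) \<longleftrightarrow> wf_atom S a"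
| "wf_form S (Neg F) \<longleftrightarrow> wf_form S F"
| "wf_form S (And F G) \<longleftrightarrow> wf_form S F \<and> wf_form S G"
| "wf_form S (All x F) \<longleftrightarrow> wf_form S F"

fun quantifier_free :: "'v form \<Rightarrow> bool" where
  "quantifier_free (Atom a) \<longleftrightarrow> True"
| "quantifier_free (Neg F) \<longleftrightarrow> quantifier_free F"
| "quantifier_free (And F G) \<longleftrightarrow> quantifier_free F \<and> quantifier_free G"
| "quantifier_free (All x F) \<longleftrightarrow> False"

fun free_vars :: "'v form \<Rightarrow> 'v set" where
  "free_vars (Atom a) = set_atom a"
| "free_vars (Neg F) = free_vars F"
| "free_vars (And F G) = free_vars F \<union> free_vars G"
| "free_vars (All x F) = free_vars F - {x}"

record 'u struct =
  dom :: "'u set"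
  fint :: "fsym \<Rightarrow> 'u list \<Rightarrow> 'u"
  pint :: "psym \<Rightarrow> 'u list \<Rightarrow> bool"

definition is_struct :: "'u struct \<Rightarrow> bool" where
  "is_struct M \<longleftrightarrow> dom M \<noteq> {} \<and>
     (\<forall>f us. set us \<subseteq> dom M \<and> length us = farity f \<longrightarrow> fint M f us \<in> dom M)"

fun tval :: "'u struct \<Rightarrow> ('v \<Rightarrow> 'u) \<Rightarrow> 'v trm \<Rightarrow> 'u" where
  "tval M \<sigma> (Var x) = \<sigma> x"
| "tval M \<sigma> (App f ts) = fint M f (map (tval M \<sigma>) ts)"

fun sat_atom :: "'u struct \<Rightarrow> ('v \<Rightarrow> 'u) \<Rightarrow> 'v atom \<Rightarrow> bool" where
  "sat_atom M \<sigma> (Equal s t) \<longleftrightarrow> tval M \<sigma> s = tval M \<sigma> t"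
| "sat_atom M \<sigma> (Pred p ts) \<longleftrightarrow> pint M p (map (tval M \<sigma>) ts)"

fun sat :: "'u struct \<Rightarrow> ('v \<Rightarrow> 'u) \<Rightarrow> 'v form \<Rightarrow> bool" where
  "sat M \<sigma> (Atom a) \<longleftrightarrow> sat_atom M \<sigma> a"
| "sat M \<sigma> (Neg F) \<longleftrightarrow> \<not> sat M \<sigma> F"
| "sat M \<sigma> (And F G) \<longleftrightarrow> sat M \<sigma> F \<and> sat M \<sigma> G"
| "sat M \<sigma> (All x F) \<longleftrightarrow> (\<forall>u\<in>dom M. sat M (\<sigma>(x := u)) F)"

definition sats :: "'u struct \<Rightarrow> ('v \<Rightarrow> 'u) \<Rightarrow> 'v form set \<Rightarrow> bool" where
  "sats M \<sigma> \<Phi> \<longleftrightarrow> (\<forall>F\<in>\<Phi>. sat M \<sigma> F)"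


section \<open>Theories\<close>

text \<open>Sentences are written with variables from \<^typ>\<open>nat\<close>, independently of the type of the
  integer variables.\<close>

definition is_theory :: "signature \<Rightarrow> nat form set \<Rightarrow> bool" where
  "is_theory S T \<longleftrightarrow> (\<forall>F\<in>T. wf_form S F \<and> free_vars F = {})"

text \<open>Domains of interpretations are nonempty subsets of the natural numbers. This is no loss: the
  stock of symbols is countable, and every set of formulas tested for consistency below either has
  finitely many variables or equates every variable with a numeral, so by the downward
  Loewenheim-Skolem theorem it has a model iff it has a countable one, and an infinite model iff it
  has a countably infinite one.\<close>

definition interp :: "nat form set \<Rightarrow> nat struct \<Rightarrow> ('v \<Rightarrow> nat) \<Rightarrow> bool" where
  "interp T M \<sigma> \<longleftrightarrow> is_struct M \<and> range \<sigma> \<subseteq> dom M \<and>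
     (\<forall>F\<in>T. \<forall>\<rho>. range \<rho> \<subseteq> dom M \<longrightarrow> sat M \<rho> F)"

definition consistent :: "nat form set \<Rightarrow> 'v form set \<Rightarrow> bool" where
  "consistent T \<Phi> \<longleftrightarrow> (\<exists>M \<sigma>. interp T M \<sigma> \<and> sats M \<sigma> \<Phi>)"

definition entails :: "nat form set \<Rightarrow> 'v form set \<Rightarrow> 'v form \<Rightarrow> bool" where
  "entails T \<Phi> G \<longleftrightarrow> \<not> consistent T (insert (Neg G) \<Phi>)"

definition stably_infinite :: "signature \<Rightarrow> nat form set \<Rightarrow> bool" where
  "stably_infinite S T \<longleftrightarrow>
     (\<forall>F :: nat form. wf_form S F \<and> quantifier_free F \<and> consistent T {F} \<longrightarrow>
        (\<exists>M (\<sigma> :: nat \<Rightarrow> nat). interp T M \<sigma> \<and> sat M \<sigma> F \<and> infinite (dom M)))"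


section \<open>Decidability\<close>

text \<open>Partial recursive functions: \<open>computes p xs y\<close> holds of a program, its list of arguments and
  its result whenever the computation halts.\<close>

datatype recf = Zero | Succ | Proj nat | Comp recf "recf list" | Prim recf recf | Mu recf

inductive computes :: "recf \<Rightarrow> nat list \<Rightarrow> nat \<Rightarrow> bool" where
  "computes Zero xs 0"
| "computes Succ (x # xs) (Suc x)"
| "i < length xs \<Longrightarrow> computes (Proj i) xs (xs ! i)"
| "list_all2 (\<lambda>g y. computes g xs y) gs ys \<Longrightarrow> computes f ys z \<Longrightarrow> computes (Comp f gs) xs z"
| "computes f xs y \<Longrightarrow> computes (Prim f g) (0 # xs) y"
| "computes (Prim f g) (n # xs) r \<Longrightarrow> computes g (n # r # xs) y
     \<Longrightarrow> computes (Prim f g) (Suc n # xs) y"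
| "computes f (n # xs) 0 \<Longrightarrow> (\<forall>m<n. \<exists>k. computes f (m # xs) (Suc k)) \<Longrightarrow> computes (Mu f) xs n"

fun code_fsym :: "fsym \<Rightarrow> nat" where
  "code_fsym (Num i) = prod_encode (0, int_encode i)"
| "code_fsym Plus = prod_encode (1, 0)"
| "code_fsym Minus = prod_encode (2, 0)"
| "code_fsym (Fn f k) = prod_encode (3, prod_encode (f, k))"

fun code_psym :: "psym \<Rightarrow> nat" where
  "code_psym Leq = prod_encode (0, 0)"
| "code_psym (Pr p k) = prod_encode (1, prod_encode (p, k))"

fun code_trm :: "nat trm \<Rightarrow> nat" where
  "code_trm (Var x) = prod_encode (0, x)"
| "code_trm (App f ts) =
     prod_encode (1, prod_encode (code_fsym f, list_encode (map code_trm ts)))"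

fun code_atom :: "nat atom \<Rightarrow> nat" where
  "code_atom (Equal s t) = prod_encode (0, prod_encode (code_trm s, code_trm t))"
| "code_atom (Pred p ts) =
     prod_encode (1, prod_encode (code_psym p, list_encode (map code_trm ts)))"

fun code_form :: "nat form \<Rightarrow> nat" where
  "code_form (Atom a) = prod_encode (0, code_atom a)"
| "code_form (Neg F) = prod_encode (1, code_form F)"
| "code_form (And F G) = prod_encode (2, prod_encode (code_form F, code_form G))"
| "code_form (All x F) = prod_encode (3, prod_encode (x, code_form F))"

definition decidable_theory :: "signature \<Rightarrow> nat form set \<Rightarrow> bool" where
  "decidable_theory S T \<longleftrightarrow>
     (\<exists>p. \<forall>F. wf_form S F \<and> quantifier_free F \<longrightarrow>
        computes p [code_form F] (if consistent T {F} then 1 else 0))"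


section \<open>Linear integer arithmetic\<close>

definition sig_Z :: signature where
  "sig_Z = \<lparr>funs = range Num \<union> {Plus, Minus}, preds = {Leq}\<rparr>"

text \<open>The values at arguments of the wrong length and at symbols outside \<open>sig_Z\<close> are
  immaterial.\<close>

fun fint_Z :: "fsym \<Rightarrow> int list \<Rightarrow> int" where
  "fint_Z (Num i) us = i"
| "fint_Z Plus us = us ! 0 + us ! 1"
| "fint_Z Minus us = us ! 0 - us ! 1"
| "fint_Z (Fn f k) us = 0"

fun pint_Z :: "psym \<Rightarrow> int list \<Rightarrow> bool" where
  "pint_Z Leq us \<longleftrightarrow> us ! 0 \<le> us ! 1"
| "pint_Z (Pr p k) us \<longleftrightarrow> False"

definition std_Z :: "int struct" where
  "std_Z = \<lparr>dom = UNIV, fint = fint_Z, pint = pint_Z\<rparr>"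

definition theory_Z :: "nat form set" where
  "theory_Z = {F. wf_form sig_Z F \<and> free_vars F = {} \<and> (\<forall>\<rho>. sat std_Z \<rho> F)}"


section \<open>Integer linear constraints\<close>

type_synonym 'v lexp = "(int \<times> 'v) list"
type_synonym 'v assignment = "'v \<Rightarrow> int"

datatype rel = RLt | RLe | REq | RGt | RGe
datatype 'v lcon = LCon "'v lexp" rel int

definition lval :: "'v assignment \<Rightarrow> 'v lexp \<Rightarrow> int" where
  "lval A e = (\<Sum>(c, v)\<leftarrow>e. c * A v)"

fun rel_holds :: "rel \<Rightarrow> int \<Rightarrow> int \<Rightarrow> bool" where
  "rel_holds RLt a b \<longleftrightarrow> a < b"
| "rel_holds RLe a b \<longleftrightarrow> a \<le> b"
| "rel_holds REq a b \<longleftrightarrow> a = b"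
| "rel_holds RGt a b \<longleftrightarrow> a > b"
| "rel_holds RGe a b \<longleftrightarrow> a \<ge> b"

fun satisfies :: "'v assignment \<Rightarrow> 'v lcon \<Rightarrow> bool" where
  "satisfies A (LCon e r b) \<longleftrightarrow> rel_holds r (lval A e) b"

definition simple_equality :: "'v lcon \<Rightarrow> bool" where
  "simple_equality d \<longleftrightarrow>
     (\<exists>v c. d = LCon [(1, v)] REq c) \<or> (\<exists>v w c. d = LCon [(1, v), (-1, w)] REq c)"

text \<open>A constraint as a formula over \<open>sig_Z\<close>. As the signature has no multiplication, a
  multiple of a variable is written as an iterated sum.\<close>

abbreviation num :: "int \<Rightarrow> 'v trm" where "num i \<equiv> App (Num i) []"
abbreviation plus :: "'v trm \<Rightarrow> 'v trm \<Rightarrow> 'v trm" where "plus s t \<equiv> App Plus [s, t]"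
abbreviation minus :: "'v trm \<Rightarrow> 'v trm \<Rightarrow> 'v trm" where "minus s t \<equiv> App Minus [s, t]"
abbreviation leq :: "'v trm \<Rightarrow> 'v trm \<Rightarrow> 'v form" where "leq s t \<equiv> Atom (Pred Leq [s, t])"
abbreviation eq :: "'v trm \<Rightarrow> 'v trm \<Rightarrow> 'v form" where "eq s t \<equiv> Atom (Equal s t)"

fun nat_mult_trm :: "nat \<Rightarrow> 'v \<Rightarrow> 'v trm" where
  "nat_mult_trm 0 v = num 0"
| "nat_mult_trm (Suc n) v = plus (Var v) (nat_mult_trm n v)"

definition mult_trm :: "int \<Rightarrow> 'v \<Rightarrow> 'v trm" where
  "mult_trm c v =
     (if 0 \<le> c then nat_mult_trm (nat c) v else minus (num 0) (nat_mult_trm (nat (- c)) v))"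

fun lexp_trm :: "'v lexp \<Rightarrow> 'v trm" where
  "lexp_trm [] = num 0"
| "lexp_trm ((c, v) # e) = plus (mult_trm c v) (lexp_trm e)"

fun rel_form :: "rel \<Rightarrow> 'v trm \<Rightarrow> 'v trm \<Rightarrow> 'v form" where
  "rel_form RLt s t = Neg (leq t s)"
| "rel_form RLe s t = leq s t"
| "rel_form REq s t = eq s t"
| "rel_form RGt s t = Neg (leq s t)"
| "rel_form RGe s t = leq t s"

fun lcon_form :: "'v lcon \<Rightarrow> 'v form" where
  "lcon_form (LCon e r b) = rel_form r (lexp_trm e) (num b)"

definition lcons_forms :: "'v lcon set \<Rightarrow> 'v form set" where
  "lcons_forms C = lcon_form ` C"

definition assignment_forms :: "'v assignment \<Rightarrow> 'v form set" where
  "assignment_forms A = {eq (Var v) (num (A v)) | v. True}"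


section \<open>ILP Modulo T\<close>

datatype 'v iatom = Plain "'v atom" | Annotated "'v atom" 'v

fun wf_iatom :: "signature \<Rightarrow> 'v iatom \<Rightarrow> bool" where
  "wf_iatom S (Plain t) \<longleftrightarrow> wf_atom S t"
| "wf_iatom S (Annotated t v) \<longleftrightarrow> wf_atom S t"

fun iatom_form :: "'v iatom \<Rightarrow> 'v form" where
  "iatom_form (Plain t) = Atom t"
| "iatom_form (Annotated t v) = Iff (Atom t) (rel_form RGt (Var v) (num 0))"

definition iatoms_forms :: "'v iatom set \<Rightarrow> 'v form set" where
  "iatoms_forms I = iatom_form ` I"

definition ilp_instance ::
    "signature \<Rightarrow> 'v lcon set \<Rightarrow> 'v iatom set \<Rightarrow> 'v lexp \<Rightarrow> bool" where
  "ilp_instance S C I Ob \<longleftrightarrow> finite C \<and> finite I \<and> (\<forall>t\<in>I. wf_iatom S t)"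

text \<open>An assignment fixes the truth values of the linear constraints but not the interpretation
  of the symbols of \<open>T\<close>. So being a \<open>T\<close>-model of \<open>C \<and> I\<close> asks that the assignment entails \<open>C\<close>
  and that it is consistent jointly with \<open>I\<close>; asking it to entail \<open>I\<close> would demand that \<open>I\<close> hold
  in every model of \<open>T\<close> in which the variables have the given values. Consistency must be relative
  to integer arithmetic as well, as otherwise distinct numerals might coincide.\<close>

definition T_model ::
    "nat form set \<Rightarrow> 'v assignment \<Rightarrow> 'v lcon set \<Rightarrow> 'v iatom set \<Rightarrow> bool" where
  "T_model T A C I \<longleftrightarrow>
     consistent (theory_Z \<union> T) (assignment_forms A \<union> iatoms_forms I) \<and>
     (\<forall>c\<in>C. entails (theory_Z \<union> T) (assignment_forms A) (lcon_form c))"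


section \<open>The transition system\<close>

type_synonym 'v subproblem = "'v lcon set \<times> 'v lcon set"

datatype 'v incumbent = NoSol | Sol "'v assignment" | SolInf "'v assignment"

type_synonym 'v state = "'v subproblem set \<times> 'v incumbent"

fun obj :: "'v lexp \<Rightarrow> 'v incumbent \<Rightarrow> ereal" where
  "obj Ob NoSol = \<infinity>"
| "obj Ob (Sol A) = ereal (real_of_int (lval A Ob))"
| "obj Ob (SolInf A) = -\<infinity>"

definition lower_bound_fun :: "'v lexp \<Rightarrow> ('v subproblem \<Rightarrow> ereal) \<Rightarrow> bool" where
  "lower_bound_fun Ob lb \<longleftrightarrow>
     (\<forall>C D. (\<forall>d\<in>D. simple_equality d) \<longrightarrow>
        \<not> (\<exists>A. (\<forall>c\<in>C \<union> D. satisfies A c) \<and> obj Ob (Sol A) < lb (C, D)))"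

inductive bc_step ::
    "signature \<Rightarrow> nat form set \<Rightarrow> 'v iatom set \<Rightarrow> 'v lexp \<Rightarrow> ('v subproblem \<Rightarrow> ereal) \<Rightarrow>
     'v state \<Rightarrow> 'v state \<Rightarrow> bool"
  for S T I Ob lb where
  Branch: "bc_step S T I Ob lb (insert (C, D) P, A) (P \<union> {(C', D) | C'. C' \<in> Cs}, A)"
    if "(C, D) \<notin> P" and "finite Cs" and "card Cs > 1" and "\<forall>C'\<in>Cs. finite C'"
      \<comment> \<open>\<open>D \<and> \<not> (C \<longleftrightarrow> \<Or> Cs)\<close> is inconsistent with integer arithmetic\<close>
      and "\<not> (\<exists>M \<sigma>. interp theory_Z M \<sigma> \<and> sats M \<sigma> (lcons_forms D) \<and>
             \<not> (sats M \<sigma> (lcons_forms C) \<longleftrightarrow> (\<exists>C'\<in>Cs. sats M \<sigma> (lcons_forms C'))))"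
| Learn: "bc_step S T I Ob lb (insert (C, D) P, A) (P \<union> {(insert c C, D)}, A)"
    if "(C, D) \<notin> P" and "c \<notin> C" and "entails theory_Z (lcons_forms (C \<union> D)) (lcon_form c)"
| Forget: "bc_step S T I Ob lb (insert (insert c C, D) P, A) (P \<union> {(C, D)}, A)"
    if "(insert c C, D) \<notin> P" and "c \<notin> C"
      and "entails theory_Z (lcons_forms (C \<union> D)) (lcon_form c)"
| Propagate: "bc_step S T I Ob lb (insert (C, D) P, A) (P \<union> {(C, insert d D)}, A)"
    if "(C, D) \<notin> P" and "d \<notin> D" and "simple_equality d"
      and "entails theory_Z (lcons_forms (C \<union> D)) (lcon_form d)"
| Drop: "bc_step S T I Ob lb (insert (C, D) P, A) (P, A)"
    if "(C, D) \<notin> P" and "\<not> (\<exists>B. \<forall>c\<in>C \<union> D. satisfies B c)"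
| Prune: "bc_step S T I Ob lb (insert (C, D) P, A) (P, A)"
    if "(C, D) \<notin> P" and "A \<noteq> NoSol" and "lb (C, D) \<ge> obj Ob A"
| Retire: "bc_step S T I Ob lb (insert (C, D) P, A) (P, Sol A')"
    if "(C, D) \<notin> P" and "T_model T A' (C \<union> D) I" and "obj Ob (Sol A') < obj Ob A"
      and "\<forall>B. T_model T B (C \<union> D) I \<longrightarrow> obj Ob (Sol A') \<le> obj Ob (Sol B)"
| Unbounded: "bc_step S T I Ob lb (insert (C, D) P, A) ({}, SolInf A')"
    if "(C, D) \<notin> P" and "T_model T A' (C \<union> D) I" and "obj Ob (Sol A') \<le> obj Ob A"
      and "\<forall>k :: int. \<exists>B. T_model T B (C \<union> D) I \<and> lval B Ob < k"
| T_Learn: "bc_step S T I Ob lb (insert (C, D) P, A) (P \<union> {(insert c C, D)}, A)"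
    if "(C, D) \<notin> P" and "c \<notin> C" and "wf_form (sig_union sig_Z S) F"
      and "entails theory_Z (lcons_forms (C \<union> D)) F"
      and "entails T (insert F (iatoms_forms I)) (lcon_form c)"

end

theory Submission
  imports Defs "HOL-Library.Countable_Set"
begin

text \<open>If the instance has \<open>T\<close>-models, one application of Unbounded or Retire finishes. Otherwise
  one Branch splits on the signs of \<open>x\<close> and \<open>x - y\<close> for all variables \<open>x\<close>, \<open>y\<close> of \<open>I\<close>. By the
  Nelson-Oppen argument, a sign pattern that is realised by an integer solution of \<open>C\<close> and that is
  \<open>T\<close>-consistent with \<open>I\<close> would yield a \<open>T\<close>-model of the instance: stable infinity provides a
  countably infinite model of \<open>T\<close>, whose domain can be identified with the integers so that the
  variables of \<open>I\<close> get the prescribed values. Hence every pattern is \<open>T\<close>-inconsistent with \<open>I\<close>,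
  T-Learn adds the constraint \<open>0 < 0\<close> to every branch, and Drop removes all of them.\<close>

section \<open>Satisfaction\<close>

lemma finite_set_trm: "finite (set_trm t)"
  by (induction t) auto

lemma finite_set_atom: "finite (set_atom a)"
  by (cases a) (auto simp: finite_set_trm)

lemma finite_free_vars: "finite (free_vars F)"
  by (induction F) (auto simp: finite_set_atom)

lemma tval_cong: "(\<And>x. x \<in> set_trm t \<Longrightarrow> \<sigma> x = \<tau> x) \<Longrightarrow> tval M \<sigma> t = tval M \<tau> t"
proof (induction t)
  case (App f ts)
  then have "map (tval M \<sigma>) ts = map (tval M \<tau>) ts" by auto
  then show ?case by (simp only: tval.simps)
qed simp

lemma sat_atom_cong:
  assumes "\<And>x. x \<in> set_atom a \<Longrightarrow> \<sigma> x = \<tau> x"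
  shows "sat_atom M \<sigma> a \<longleftrightarrow> sat_atom M \<tau> a"
proof (cases a)
  case (Equal s t)
  then show ?thesis using assms tval_cong[of s \<sigma> \<tau> M] tval_cong[of t \<sigma> \<tau> M] by simp
next
  case (Pred p ts)
  then have "map (tval M \<sigma>) ts = map (tval M \<tau>) ts"
    using assms by (auto intro!: tval_cong)
  then show ?thesis using Pred by (simp only: sat_atom.simps)
qed

lemma sat_cong:
  "(\<And>x. x \<in> free_vars F \<Longrightarrow> \<sigma> x = \<tau> x) \<Longrightarrow> sat M \<sigma> F \<longleftrightarrow> sat M \<tau> F"
proof (induction F arbitrary: \<sigma> \<tau>)
  case (Atom a)
  then show ?case using sat_atom_cong[of a \<sigma> \<tau> M] by simp
next
  case (Neg F)
  have "sat M \<sigma> F \<longleftrightarrow> sat M \<tau> F" by (rule Neg.IH) (use Neg.prems in auto)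
  then show ?case by simp
next
  case (And F G)
  have "sat M \<sigma> F \<longleftrightarrow> sat M \<tau> F" by (rule And.IH) (use And.prems in auto)
  moreover have "sat M \<sigma> G \<longleftrightarrow> sat M \<tau> G" by (rule And.IH) (use And.prems in auto)
  ultimately show ?case by simp
next
  case (All x F)
  have "sat M (\<sigma>(x := u)) F \<longleftrightarrow> sat M (\<tau>(x := u)) F" for u
    by (rule All.IH) (use All.prems in auto)
  then show ?case by simp
qed

section \<open>Renaming of variables\<close>

lemma tval_map: "tval M \<sigma> (map_trm f t) = tval M (\<sigma> \<circ> f) t"
proof (induction t)
  case (App g ts)
  then have "map (tval M \<sigma>) (map (map_trm f) ts) = map (tval M (\<sigma> \<circ> f)) ts" by (simp add: comp_def)
  then show ?case by (simp only: tval.simps trm.map)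
qed simp

lemma sat_atom_map: "sat_atom M \<sigma> (map_atom f a) \<longleftrightarrow> sat_atom M (\<sigma> \<circ> f) a"
  by (cases a) (simp_all add: tval_map comp_def)

lemma sat_map:
  "quantifier_free F \<Longrightarrow> sat M \<sigma> (map_form f F) \<longleftrightarrow> sat M (\<sigma> \<circ> f) F"
  by (induction F) (auto simp: sat_atom_map)

lemma wf_trm_map: "wf_trm S (map_trm f t) \<longleftrightarrow> wf_trm S t"
  by (induction t) auto

lemma wf_form_map: "wf_form S (map_form f F) \<longleftrightarrow> wf_form S F"
proof (induction F)
  case (Atom a)
  then show ?case by (cases a) (auto simp: wf_trm_map)
qed auto

lemma quantifier_free_map: "quantifier_free (map_form f F) \<longleftrightarrow> quantifier_free F"
  by (induction F) auto

section \<open>Change of structure: reducts and isomorphisms\<close>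

lemma tval_mono_sig:
  assumes "\<And>f us. f \<in> funs S \<Longrightarrow> fint N f us = fint M f us" "wf_trm S t"
  shows "tval N \<sigma> t = tval M \<sigma> t"
  using assms(2)
proof (induction t)
  case (App f ts)
  then have "map (tval N \<sigma>) ts = map (tval M \<sigma>) ts" by auto
  then show ?case using App.prems assms(1)[of f] by (simp only: tval.simps wf_trm.simps)
qed simp

lemma sat_sig_cong:
  assumes fs: "\<And>f us. f \<in> funs S \<Longrightarrow> fint N f us = fint M f us"
    and ps: "\<And>p us. p \<in> preds S \<Longrightarrow> pint N p us = pint M p us"
    and d: "dom N = dom M" and "wf_form S F"
  shows "sat N \<sigma> F \<longleftrightarrow> sat M \<sigma> F"
  using \<open>wf_form S F\<close>
proof (induction F arbitrary: \<sigma>)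
  case (Atom a)
  show ?case
  proof (cases a)
    case (Equal s t)
    then show ?thesis using Atom by (simp add: tval_mono_sig[of S N M, OF fs])
  next
    case (Pred p ts)
    then have "map (tval N \<sigma>) ts = map (tval M \<sigma>) ts"
      using Atom by (auto intro!: tval_mono_sig[of S N M, OF fs])
    then show ?thesis using Atom Pred ps[of p]
      by (simp only: sat.simps sat_atom.simps wf_form.simps wf_atom.simps)
  qed
qed (auto simp: d)

text \<open>Injectivity of \<open>h\<close> preserves equations and surjectivity preserves
  quantifiers. Compatibility is asked only for symbols of \<open>S\<close>, so the lemma also
  applies when just the \<open>S\<close>-reducts are isomorphic.\<close>

lemma sat_iso:
  assumes h: "bij_betw h (dom M) (dom N)"
    and fs: "\<And>f us. f \<in> funs S \<Longrightarrow> set us \<subseteq> dom M \<Longrightarrow> length us = farity f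
               \<Longrightarrow> fint N f (map h us) = h (fint M f us)"
    and ps: "\<And>p us. p \<in> preds S \<Longrightarrow> set us \<subseteq> dom M \<Longrightarrow> length us = parity p
               \<Longrightarrow> pint N p (map h us) = pint M p us"
    and M: "is_struct M" and "wf_form S F" and "range \<sigma> \<subseteq> dom M"
  shows "sat N (h \<circ> \<sigma>) F \<longleftrightarrow> sat M \<sigma> F"
proof -
  have T: "tval M \<sigma> t \<in> dom M \<and> tval N (h \<circ> \<sigma>) t = h (tval M \<sigma> t)"
    if "wf_trm S t" "range \<sigma> \<subseteq> dom M" for t \<sigma>
    using that(1)
  proof (induction t)
    case (Var x)
    then show ?case using that by auto
  next
    case (App f ts)
    let ?us = "map (tval M \<sigma>) ts"
    have us: "set ?us \<subseteq> dom M" "length ?us = farity f" "f \<in> funs S" using App by auto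
    have eq: "map (tval N (h \<circ> \<sigma>)) ts = map h ?us" using App by (auto simp: comp_def)
    show ?case
      using M us fs[OF us(3,1,2)] unfolding tval.simps eq by (auto simp: is_struct_def)
  qed
  show ?thesis using \<open>wf_form S F\<close> \<open>range \<sigma> \<subseteq> dom M\<close>
  proof (induction F arbitrary: \<sigma>)
    case (Atom a)
    show ?case
    proof (cases a)
      case (Equal s t)
      then show ?thesis using Atom T[of s \<sigma>] T[of t \<sigma>] h
        by (auto simp: bij_betw_def inj_on_def comp_def)
    next
      case (Pred p ts)
      have eq: "map (tval N (h \<circ> \<sigma>)) ts = map h (map (tval M \<sigma>) ts)"
        using Atom T Pred by (auto simp: comp_def)
      have "pint N p (map h (map (tval M \<sigma>) ts)) = pint M p (map (tval M \<sigma>) ts)"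
        by (rule ps) (use Atom T Pred in auto)
      then show ?thesis using Pred eq by (simp only: sat.simps sat_atom.simps)
    qed
  next
    case (All x F)
    have *: "(h \<circ> \<sigma>)(x := h u) = h \<circ> \<sigma>(x := u)" for u by auto
    have "sat N ((h \<circ> \<sigma>)(x := h u)) F \<longleftrightarrow> sat M (\<sigma>(x := u)) F" if "u \<in> dom M" for u
      unfolding * by (rule All.IH) (use All.prems that in auto)
    moreover have "dom N = h ` dom M" using h by (simp add: bij_betw_def)
    ultimately show ?case by (simp add: comp_def)
  qed (auto simp: comp_def)
qed

text \<open>The syntax has no constant for truth; the trivial equation replaces it and is
  well-formed over every signature.\<close>

fun Conj :: "'v form list \<Rightarrow> 'v form" where
  "Conj [] = eq (Var undefined) (Var undefined)"
| "Conj (F # Fs) = And F (Conj Fs)"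

lemma sat_Conj: "sat M \<sigma> (Conj Fs) \<longleftrightarrow> sats M \<sigma> (set Fs)"
  by (induction Fs) (auto simp: sats_def)

lemma wf_form_Conj: "wf_form S (Conj Fs) \<longleftrightarrow> (\<forall>F\<in>set Fs. wf_form S F)"
  by (induction Fs) auto

lemma quantifier_free_Conj: "quantifier_free (Conj Fs) \<longleftrightarrow> (\<forall>F\<in>set Fs. quantifier_free F)"
  by (induction Fs) auto

lemma sat_Iff: "sat M \<sigma> (Iff F G) \<longleftrightarrow> (sat M \<sigma> F \<longleftrightarrow> sat M \<sigma> G)"
  by (auto simp: Iff_def)


section \<open>Models of linear integer arithmetic\<close>

lemma sat_foldr_All:
  assumes "\<And>\<rho>. range \<rho> \<subseteq> dom M \<Longrightarrow> sat M \<rho> (foldr All xs F)" "range \<rho> \<subseteq> dom M"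
  shows "sat M \<rho> F"
  using assms
proof (induction xs)
  case (Cons x xs)
  have "sat M \<rho> (foldr All xs F)" if r: "range \<rho> \<subseteq> dom M" for \<rho>
  proof -
    \<comment> \<open>Instantiating the quantifier with \<open>\<rho> x\<close>, an element of the
      domain, leaves the valuation unchanged.\<close>
    have "sat M (\<rho>(x := \<rho> x)) (foldr All xs F)"
      using Cons.prems(1)[OF r] r by (simp del: fun_upd_triv) blast
    then show ?thesis by simp
  qed
  then show ?case using Cons.IH Cons.prems(2) by blast
qed simp

lemma free_vars_foldr_All: "free_vars (foldr All xs F) = free_vars F - set xs"
  by (induction xs) auto

lemma wf_form_foldr_All: "wf_form S (foldr All xs F) \<longleftrightarrow> wf_form S F"
  by (induction xs) auto

lemma valid_foldr_All: "(\<And>\<rho>. sat M \<rho> F) \<Longrightarrow> sat M \<rho> (foldr All xs F)"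
  by (induction xs arbitrary: \<rho>) auto

text \<open>The variables of the formula may have any type, those of the theory are natural numbers:
  the formula is renamed before it is closed.\<close>

lemma theory_Z_valid:
  assumes "wf_form sig_Z F" "quantifier_free F" "\<And>A. sat std_Z A F" "interp theory_Z M \<sigma>"
  shows "sat M \<sigma> F"
proof -
  obtain f :: "_ \<Rightarrow> nat" where f: "inj_on f (free_vars F)"
    using inj_on_to_nat_on[OF countable_finite[OF finite_free_vars]] by blast
  define G where "G = map_form f F"
  obtain xs where xs: "set xs = free_vars G" using finite_list[OF finite_free_vars] ..
  have "foldr All xs G \<in> theory_Z"
    unfolding theory_Z_def using assms xs
    by (auto simp: wf_form_foldr_All free_vars_foldr_All G_def wf_form_map sat_map
        intro!: valid_foldr_All)
  then have G: "sat M \<rho> G" if "range \<rho> \<subseteq> dom M" for \<rho>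
    using sat_foldr_All[of M xs G \<rho>] assms(4) that unfolding interp_def by blast
  \<comment> \<open>This valuation undoes the renaming: composed with \<open>f\<close> it agrees
    with \<open>\<sigma>\<close> on the free variables of \<open>F\<close>.\<close>
  let ?\<rho> = "\<sigma> \<circ> inv_into (free_vars F) f"
  have "sat M ?\<rho> G" using assms(4) by (intro G) (auto simp: interp_def)
  then have "sat M (?\<rho> \<circ> f) F" unfolding G_def using assms(2) by (simp only: sat_map)
  moreover have "sat M (?\<rho> \<circ> f) F \<longleftrightarrow> sat M \<sigma> F" by (rule sat_cong) (use f in auto)
  ultimately show ?thesis by blast
qed

text \<open>Finiteness turns the entailment into one valid formula, so it carries over from the
  integers to every model of \<open>theory_Z\<close>, including nonstandard ones.\<close>

lemma theory_Z_entailment: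
  assumes "finite \<Phi>" "\<And>F. F \<in> \<Phi> \<Longrightarrow> wf_form sig_Z F \<and> quantifier_free F"
    and "wf_form sig_Z G" "quantifier_free G"
    and "\<And>A. sats std_Z A \<Phi> \<Longrightarrow> sat std_Z A G"
    and "interp theory_Z M \<sigma>" "sats M \<sigma> \<Phi>"
  shows "sat M \<sigma> G"
proof -
  obtain Fs where Fs: "set Fs = \<Phi>" using finite_list[OF assms(1)] by blast
  have "sat M \<sigma> (Neg (And (Conj Fs) (Neg G)))"
    using assms(2-6) by (intro theory_Z_valid) (auto simp: wf_form_Conj quantifier_free_Conj sat_Conj Fs)
  then show ?thesis using assms(7) by (simp add: sat_Conj Fs)
qed

text \<open>Without an integer solution, \<open>\<Phi>\<close> would entail a false disequation in
  \<open>M\<close>.\<close>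

lemma theory_Z_realizable:
  assumes "finite \<Phi>" "\<And>F. F \<in> \<Phi> \<Longrightarrow> wf_form sig_Z F \<and> quantifier_free F"
    and "interp theory_Z M \<sigma>" "sats M \<sigma> \<Phi>"
  obtains A where "sats std_Z A \<Phi>"
proof -
  have False if "\<And>A. \<not> sats std_Z A \<Phi>"
    using theory_Z_entailment[OF assms(1,2) _ _ _ assms(3,4), of "Neg (eq (Var undefined) (Var undefined))"] that
    by simp
  then show ?thesis using that by blast
qed

section \<open>Constraints as formulas, and their meaning in the standard model\<close>

lemma wf_nat_mult_trm: "wf_trm sig_Z (nat_mult_trm n v)"
  by (induction n) (auto simp: sig_Z_def)

lemma wf_lexp_trm: "wf_trm sig_Z (lexp_trm e)"
  by (induction e rule: lexp_trm.induct)
     (use wf_nat_mult_trm in \<open>auto simp: sig_Z_def mult_trm_def\<close>)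

lemma wf_lcon_form: "wf_form sig_Z (lcon_form c) \<and> quantifier_free (lcon_form c)"
proof (cases c)
  case (LCon e r b)
  then show ?thesis using wf_lexp_trm by (cases r) (auto simp: sig_Z_def)
qed

lemma tval_std_nat_mult_trm: "tval std_Z A (nat_mult_trm n v) = int n * A v"
  by (induction n) (auto simp: std_Z_def algebra_simps)

lemma tval_std_lexp_trm: "tval std_Z A (lexp_trm e) = lval A e"
proof (induction e rule: lexp_trm.induct)
  case (2 c v e)
  have "tval std_Z A (mult_trm c v) = c * A v"
    using tval_std_nat_mult_trm[of A _ v] by (auto simp: mult_trm_def) (simp_all add: std_Z_def)
  then show ?case using 2 by (simp add: lval_def) (simp add: std_Z_def)
qed (simp add: std_Z_def lval_def)

lemma sat_std_lcon_form: "sat std_Z A (lcon_form c) \<longleftrightarrow> satisfies A c"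
proof (cases c)
  case (LCon e r b)
  have "tval std_Z A (num b) = b" by (simp add: std_Z_def)
  moreover have "pint std_Z Leq [x, y] \<longleftrightarrow> x \<le> y" for x y by (simp add: std_Z_def)
  ultimately show ?thesis using LCon tval_std_lexp_trm[of A e]
    by (cases r) (auto simp del: tval.simps)
qed

lemma sats_std_lcons_forms: "sats std_Z A (lcons_forms C) \<longleftrightarrow> (\<forall>c\<in>C. satisfies A c)"
  by (auto simp: sats_def lcons_forms_def sat_std_lcon_form)

lemma interp_mono: "interp T M \<sigma> \<Longrightarrow> T' \<subseteq> T \<Longrightarrow> interp T' M \<sigma>"
  by (auto simp: interp_def)

text \<open>\<open>assignment_forms A\<close> may be infinite, but the equations for the finitely
  many variables of \<open>c\<close> already fix its truth value, and these fall under
  \<open>theory_Z_entailment\<close>.\<close>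

lemma assignment_entails_lcon:
  assumes "satisfies A c"
  shows "entails (theory_Z \<union> T) (assignment_forms A) (lcon_form c)"
proof -
  have "sat M \<sigma> (lcon_form c)"
    if M: "interp (theory_Z \<union> T) M \<sigma>" and s: "sats M \<sigma> (assignment_forms A)" for M \<sigma>
  proof (rule theory_Z_entailment)
    let ?\<Phi> = "(\<lambda>v. eq (Var v) (num (A v))) ` free_vars (lcon_form c)"
    show "finite ?\<Phi>" using finite_free_vars by blast
    show "wf_form sig_Z F \<and> quantifier_free F" if "F \<in> ?\<Phi>" for F
      using that by (auto simp: sig_Z_def)
    show "sat std_Z B (lcon_form c)" if "sats std_Z B ?\<Phi>" for B
    proof -
      have "sat std_Z B (lcon_form c) \<longleftrightarrow> sat std_Z A (lcon_form c)"
        by (rule sat_cong) (use that in \<open>auto simp: sats_def std_Z_def\<close>)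
      then show ?thesis using assms by (simp add: sat_std_lcon_form)
    qed
    show "sats M \<sigma> ?\<Phi>" using s by (auto simp: sats_def assignment_forms_def)
  qed (use wf_lcon_form M in \<open>auto intro: interp_mono\<close>)
  then show ?thesis by (auto simp: entails_def consistent_def sats_def)
qed


section \<open>Combining models\<close>

text \<open>By \<open>inj\<close>, sending \<open>a x\<close> to \<open>b x\<close> is a bijection
  between finite sets. Their complements are both countably infinite, so it extends to all of the
  integers.\<close>

lemma bij_betw_extend_finite:
  fixes a :: "'v \<Rightarrow> int" and b :: "'v \<Rightarrow> nat"
  assumes "finite V" "infinite D" "b ` V \<subseteq> D"
    and inj: "\<And>x y. x \<in> V \<Longrightarrow> y \<in> V \<Longrightarrow> a x = a y \<longleftrightarrow> b x = b y"
  obtains h where "bij_betw h UNIV D" "\<And>x. x \<in> V \<Longrightarrow> h (a x) = b x"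
proof -
  \<comment> \<open>Any variable with value \<open>k\<close> will do, since all of them have the
    same image under \<open>b\<close>.\<close>
  define g where "g k = b (SOME x. x \<in> V \<and> a x = k)" for k
  have g: "g (a x) = b x" if "x \<in> V" for x
  proof -
    have "(SOME y. y \<in> V \<and> a y = a x) \<in> V \<and> a (SOME y. y \<in> V \<and> a y = a x) = a x"
      by (rule someI) (use that in auto)
    then show ?thesis unfolding g_def using inj that by blast
  qed
  have 1: "bij_betw g (a ` V) (b ` V)"
    by (rule bij_betw_imageI) (auto simp: inj_on_def g inj image_image)
  have "infinite (UNIV - a ` V)" "infinite (D - b ` V)"
    using assms(1,2) by (auto simp: infinite_UNIV_int)
  then have "bij_betw (from_nat_into (D - b ` V) \<circ> to_nat_on (UNIV - a ` V)) (UNIV - a ` V) (D - b ` V)"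
    by (intro bij_betw_trans[OF to_nat_on_infinite bij_betw_from_nat_into]) auto
  then obtain e where 2: "bij_betw e (UNIV - a ` V) (D - b ` V)" by blast
  let ?h = "\<lambda>k. if k \<in> a ` V then g k else e k"
  have "bij_betw ?h (a ` V \<union> (UNIV - a ` V)) (b ` V \<union> (D - b ` V))"
  proof (rule bij_betw_combine)
    show "bij_betw ?h (a ` V) (b ` V)" using 1 by (rule bij_betw_cong[THEN iffD1, rotated]) simp
    show "bij_betw ?h (UNIV - a ` V) (D - b ` V)"
      using 2 by (rule bij_betw_cong[THEN iffD1, rotated]) simp
  qed auto
  moreover have "a ` V \<union> (UNIV - a ` V) = UNIV" "b ` V \<union> (D - b ` V) = D" using assms(3) by auto
  ultimately have "bij_betw ?h UNIV D" by (simp only:)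
  then show ?thesis using that[of ?h] g by auto
qed

text \<open>The integers are transported along \<open>h\<close> onto the domain of \<open>M\<close>;
  all symbols outside \<open>sig_Z\<close> keep their meaning.\<close>

definition Z_expansion :: "(int \<Rightarrow> nat) \<Rightarrow> nat struct \<Rightarrow> nat struct" where
  "Z_expansion h M = M\<lparr>
     fint := \<lambda>f us. if f \<in> funs sig_Z then h (fint_Z f (map (inv h) us)) else fint M f us,
     pint := \<lambda>p us. if p \<in> preds sig_Z then pint_Z p (map (inv h) us) else pint M p us\<rparr>"

lemma sat_Z_expansion_Z:
  assumes "bij_betw h UNIV (dom M)" "wf_form sig_Z F"
  shows "sat (Z_expansion h M) (h \<circ> A) F \<longleftrightarrow> sat std_Z A F"
proof (rule sat_iso)
  have "inj h" using assms(1) by (simp add: bij_betw_def)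
  then show "fint (Z_expansion h M) f (map h us) = h (fint std_Z f us)" if "f \<in> funs sig_Z" for f us
    using that by (simp add: Z_expansion_def std_Z_def)
  show "pint (Z_expansion h M) p (map h us) = pint std_Z p us" if "p \<in> preds sig_Z" for p us
    using that \<open>inj h\<close> by (simp add: Z_expansion_def std_Z_def)
qed (use assms in \<open>auto simp: Z_expansion_def std_Z_def is_struct_def\<close>)

lemma sat_Z_expansion:
  assumes "sig_disjoint S sig_Z" "wf_form S F"
  shows "sat (Z_expansion h M) \<sigma> F \<longleftrightarrow> sat M \<sigma> F"
  by (rule sat_sig_cong[of S]) (use assms in \<open>auto simp: Z_expansion_def sig_disjoint_def\<close>)

lemma interp_Z_expansion:
  assumes "is_theory S T" "sig_disjoint S sig_Z" "interp T M \<tau>" "bij_betw h UNIV (dom M)"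
  shows "interp (theory_Z \<union> T) (Z_expansion h M) (h \<circ> A)"
proof -
  have h: "h x \<in> dom M" for x using assms(4) by (auto simp: bij_betw_def)
  have d: "dom (Z_expansion h M) = dom M" by (simp add: Z_expansion_def)
  have "is_struct (Z_expansion h M)"
    using assms(3) h by (auto simp: interp_def is_struct_def Z_expansion_def)
  moreover have "sat (Z_expansion h M) \<rho> F" if "F \<in> T" "range \<rho> \<subseteq> dom M" for F \<rho>
    using that assms sat_Z_expansion[OF assms(2), of F h M \<rho>] by (auto simp: interp_def is_theory_def)
  moreover have "sat (Z_expansion h M) \<rho> F" if "F \<in> theory_Z" "range \<rho> \<subseteq> dom M" for F \<rho>
  proof -
    have "h (inv h (\<rho> x)) = \<rho> x" for x
      using that(2) assms(4) by (intro f_inv_into_f) (auto simp: bij_betw_def)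
    \<comment> \<open>As \<open>h\<close> is onto, every valuation in the domain comes from an
      integer valuation, to which truth in \<open>std_Z\<close> applies.\<close>
    then have "\<rho> = h \<circ> (inv h \<circ> \<rho>)" by auto
    then show ?thesis
      using sat_Z_expansion_Z[OF assms(4), of F "inv h \<circ> \<rho>"] that(1) by (auto simp: theory_Z_def)
  qed
  ultimately show ?thesis using h by (auto simp: interp_def d)
qed

section \<open>Equality and sign literals, and the Nelson-Oppen combination\<close>

definition iatoms_vars :: "'v iatom set \<Rightarrow> 'v set" where
  "iatoms_vars I = (\<Union>i\<in>I. free_vars (iatom_form i))"

lemma finite_iatoms_vars: "finite I \<Longrightarrow> finite (iatoms_vars I)"
  by (simp add: iatoms_vars_def finite_free_vars)

text \<open>This is the arrangement of \<open>V\<close> induced by \<open>A\<close>, in the sense of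
  Nelson and Oppen.\<close>

definition eq_literals :: "'v assignment \<Rightarrow> 'v set \<Rightarrow> 'v form set" where
  "eq_literals A V = (\<lambda>(x, y). if A x = A y then eq (Var x) (Var y) else Neg (eq (Var x) (Var y))) ` (V \<times> V)"

text \<open>With signatures disjoint, \<open>T\<close> does not constrain \<open>Leq\<close> and
  \<open>Num 0\<close>. Relative to \<open>T\<close> alone, these literals merely fix the truth
  values to which annotated atoms are tied.\<close>

definition sign_literals :: "'v assignment \<Rightarrow> 'v set \<Rightarrow> 'v form set" where
  "sign_literals A V =
     (\<lambda>v. if A v > 0 then rel_form RGt (Var v) (num 0) else Neg (rel_form RGt (Var v) (num 0))) ` V"

text \<open>Unlike the interface atoms themselves, these literals are over the signature of \<open>T\<close>, as
  stable infinity requires.\<close>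

fun iatom_literal :: "'v assignment \<Rightarrow> 'v iatom \<Rightarrow> 'v form" where
  "iatom_literal A (Plain t) = Atom t"
| "iatom_literal A (Annotated t v) = (if A v > 0 then Atom t else Neg (Atom t))"

lemma sats_eq_literals:
  "sats M \<sigma> (eq_literals A V) \<longleftrightarrow> (\<forall>x\<in>V. \<forall>y\<in>V. A x = A y \<longleftrightarrow> \<sigma> x = \<sigma> y)"
  by (auto simp: sats_def eq_literals_def split: if_splits)

lemma sats_sign_literals:
  "sats M \<sigma> (sign_literals A V) \<longleftrightarrow>
     (\<forall>v\<in>V. A v > 0 \<longleftrightarrow> sat M \<sigma> (rel_form RGt (Var v) (num 0)))"
  by (auto simp: sats_def sign_literals_def simp del: if_image_distrib split: if_splits)

text \<open>Stable infinity is stated for a single formula over \<open>nat\<close> variables: the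
  set is conjoined and renamed, and the renaming is undone by composing the valuation with
  \<open>f\<close>.\<close>

lemma stably_infinite_finite_set:
  fixes \<Phi> :: "'v form set"
  assumes "stably_infinite S T" "finite \<Phi>"
    and wf: "\<And>F. F \<in> \<Phi> \<Longrightarrow> wf_form S F \<and> quantifier_free F"
    and "consistent T \<Phi>"
  obtains M \<sigma> where "interp T M \<sigma>" "sats M \<sigma> \<Phi>" "infinite (dom M)"
proof -
  obtain Fs where Fs: "set Fs = \<Phi>" using finite_list[OF assms(2)] by blast
  let ?V = "free_vars (Conj Fs)"
  obtain f :: "_ \<Rightarrow> nat" where f: "inj_on f ?V"
    using inj_on_to_nat_on[OF countable_finite[OF finite_free_vars]] by blast
  let ?G = "map_form f (Conj Fs)"
  have qf: "quantifier_free (Conj Fs)" using wf by (simp add: quantifier_free_Conj Fs)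
  obtain M \<sigma> where M: "interp T M \<sigma>" "sats M \<sigma> \<Phi>" using assms(4) by (auto simp: consistent_def)
  let ?\<rho> = "\<sigma> \<circ> inv_into ?V f"
  have "sat M (?\<rho> \<circ> f) (Conj Fs) \<longleftrightarrow> sat M \<sigma> (Conj Fs)" by (rule sat_cong) (use f in auto)
  then have "sat M ?\<rho> ?G" using M by (simp only: sat_map[OF qf] sat_Conj Fs)
  moreover have "interp T M ?\<rho>" using M(1) by (auto simp: interp_def)
  ultimately have "consistent T {?G}" by (auto simp: consistent_def sats_def)
  moreover have "wf_form S ?G \<and> quantifier_free ?G"
    using wf qf by (simp add: wf_form_map wf_form_Conj quantifier_free_map Fs)
  ultimately obtain N and \<tau> :: "nat \<Rightarrow> nat"
    where N: "interp T N \<tau>" "sat N \<tau> ?G" "infinite (dom N)"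
    using assms(1) unfolding stably_infinite_def by blast
  have "sats N (\<tau> \<circ> f) \<Phi>" using N(2) by (simp only: sat_map[OF qf] sat_Conj Fs)
  moreover have "interp T N (\<tau> \<circ> f)" using N(1) by (auto simp: interp_def)
  ultimately show ?thesis using that N(3) by blast
qed

text \<open>Replacing annotations by the signs under \<open>A\<close> leaves formulas over
  \<open>S\<close>, which have a model with infinite domain. The arrangement allows its domain to be
  identified with the integers so that each \<open>x\<close> in \<open>iatoms_vars I\<close> gets
  the value \<open>A x\<close>; the expansion along this bijection then satisfies both
  theories.\<close>

lemma T_model_if_literals_consistent:
  assumes T: "is_theory S T" and disj: "sig_disjoint S sig_Z" and si: "stably_infinite S T"
    and I: "finite I" "\<forall>i\<in>I. wf_iatom S i" and A: "\<forall>c\<in>C. satisfies A c"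
    and cons: "consistent T (eq_literals A (iatoms_vars I) \<union> sign_literals A (iatoms_vars I) \<union> iatoms_forms I)"
  shows "T_model T A C I"
proof -
  let ?V = "iatoms_vars I"
  let ?\<Phi> = "eq_literals A ?V \<union> iatom_literal A ` I"
  obtain M \<sigma> where M: "interp T M \<sigma>" "sats M \<sigma> (eq_literals A ?V)" "sats M \<sigma> (sign_literals A ?V)"
      "sats M \<sigma> (iatoms_forms I)"
    using cons by (auto simp: consistent_def sats_def)
  have "sat M \<sigma> (iatom_literal A i)" if "i \<in> I" for i
  proof (cases i)
    case (Plain t)
    then show ?thesis using M(4) that by (force simp: sats_def iatoms_forms_def)
  next
    case (Annotated t v)
    have "v \<in> ?V" using Annotated that by (force simp: iatoms_vars_def Iff_def)
    then have "sat M \<sigma> (rel_form RGt (Var v) (num 0)) \<longleftrightarrow> A v > 0"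
      using M(3) unfolding sats_sign_literals by blast
    moreover have "sat M \<sigma> (iatom_form i)" using M(4) that by (auto simp: sats_def iatoms_forms_def)
    ultimately show ?thesis using Annotated by (auto simp: sat_Iff)
  qed
  then have "consistent T ?\<Phi>" using M by (auto simp: consistent_def sats_def)
  moreover have "finite ?\<Phi>" using I(1) by (simp add: eq_literals_def finite_iatoms_vars)
  moreover have "wf_form S F \<and> quantifier_free F" if "F \<in> ?\<Phi>" for F
  proof -
    have "wf_form S (iatom_literal A i) \<and> quantifier_free (iatom_literal A i)" if "i \<in> I" for i
      using I(2) that by (cases i) auto
    then show ?thesis using that by (auto simp: eq_literals_def)
  qed
  ultimately obtain N \<tau> where N: "interp T N \<tau>" "sats N \<tau> ?\<Phi>" "infinite (dom N)"
    using stably_infinite_finite_set[OF si] by metis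
  have "\<tau> ` ?V \<subseteq> dom N" using N(1) by (auto simp: interp_def)
  moreover have "A x = A y \<longleftrightarrow> \<tau> x = \<tau> y" if "x \<in> ?V" "y \<in> ?V" for x y
    using N(2) sats_eq_literals[of N \<tau> A ?V] that by (auto simp: sats_def)
  ultimately obtain h where h: "bij_betw h UNIV (dom N)" "\<And>x. x \<in> ?V \<Longrightarrow> h (A x) = \<tau> x"
    using bij_betw_extend_finite[OF finite_iatoms_vars[OF I(1)] N(3)] by metis
  let ?N = "Z_expansion h N"
  \<comment> \<open>In the expansion the numeral for \<open>A v\<close> denotes
    \<open>h (A v)\<close>.\<close>
  have "sat ?N (h \<circ> A) (eq (Var v) (num (A v)))" for v
    by (simp add: Z_expansion_def sig_Z_def)
  then have "sats ?N (h \<circ> A) (assignment_forms A)"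
    unfolding sats_def assignment_forms_def by blast
  moreover have "sat ?N (h \<circ> A) (iatom_form i)" if "i \<in> I" for i
  proof -
    have lit: "sat N \<tau> (iatom_literal A i)" using N(2) that by (auto simp: sats_def)
    have atom: "sat ?N (h \<circ> A) (Atom t) \<longleftrightarrow> sat N \<tau> (Atom t)"
      if "wf_atom S t" "set_atom t \<subseteq> ?V" for t
    proof -
      have "sat ?N (h \<circ> A) (Atom t) \<longleftrightarrow> sat N (h \<circ> A) (Atom t)"
        by (rule sat_Z_expansion[OF disj]) (use that in simp)
      also have "\<dots> \<longleftrightarrow> sat N \<tau> (Atom t)" by (rule sat_cong) (use that h(2) in auto)
      finally show ?thesis .
    qed
    show ?thesis
    proof (cases i)
      case (Plain t)
      then have "set_atom t \<subseteq> ?V" using that by (force simp: iatoms_vars_def)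
      then show ?thesis using Plain lit atom[of t] I(2) that by auto
    next
      case (Annotated t v)
      then have "set_atom t \<subseteq> ?V" using that by (force simp: iatoms_vars_def Iff_def)
      then have "sat ?N (h \<circ> A) (Atom t) \<longleftrightarrow> A v > 0"
        using Annotated lit atom[of t] I(2) that by (auto split: if_splits)
      \<comment> \<open>Here the comparison has regained its integer meaning, so the annotation
        again agrees with the literal chosen by the sign of \<open>A v\<close>.\<close>
      moreover have "sat ?N (h \<circ> A) (rel_form RGt (Var v) (num 0))
          \<longleftrightarrow> sat std_Z A (rel_form RGt (Var v) (num 0))"
        by (rule sat_Z_expansion_Z[OF h(1)]) (simp add: sig_Z_def)
      moreover have "\<dots> \<longleftrightarrow> A v > 0" by (auto simp: std_Z_def)
      ultimately show ?thesis using Annotated by (simp only: iatom_form.simps sat_Iff)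
    qed
  qed
  ultimately have "sats ?N (h \<circ> A) (assignment_forms A \<union> iatoms_forms I)"
    by (auto simp: sats_def iatoms_forms_def)
  then have "consistent (theory_Z \<union> T) (assignment_forms A \<union> iatoms_forms I)"
    using interp_Z_expansion[OF T disj N(1) h(1)] unfolding consistent_def by blast
  then show ?thesis using A assignment_entails_lcon by (auto simp: T_model_def)
qed


section \<open>Refuting instances without \<open>T\<close>-models\<close>

text \<open>The first, third and fourth relation decide the sign of a difference; \<open>RLe\<close>
  expresses the failure of \<open>v > 0\<close> as a constraint.\<close>

definition sign_constraints :: "'v set \<Rightarrow> 'v lcon set" where
  "sign_constraints V = (\<lambda>(e, r). LCon e r 0) `
     (((\<lambda>v. [(1, v)]) ` V \<union> (\<lambda>(x, y). [(1, x), (-1, y)]) ` (V \<times> V)) \<times> {RLt, RLe, REq, RGt})"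

definition sign_pattern :: "'v set \<Rightarrow> 'v assignment \<Rightarrow> 'v lcon set" where
  "sign_pattern V A = {c \<in> sign_constraints V. satisfies A c}"

lemma finite_sign_constraints: "finite V \<Longrightarrow> finite (sign_constraints V)"
  by (simp add: sign_constraints_def)

text \<open>The constraints true under \<open>A\<close> suffice: exactly one of \<open><\<close>,
  \<open>=\<close>, \<open>>\<close> holds of each difference, and one of \<open>RLe\<close>,
  \<open>RGt\<close> of each variable, and \<open>B\<close> must obey the same one.\<close>

lemma sign_pattern_determines_literals:
  assumes "\<forall>c\<in>sign_pattern V A. satisfies B c"
  shows "eq_literals B V = eq_literals A V" "sign_literals B V = sign_literals A V"
proof -
  have "B x = B y \<longleftrightarrow> A x = A y" if "x \<in> V" "y \<in> V" for x y
  proof -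
    have "LCon [(1, x), (-1, y)] r 0 \<in> sign_constraints V" if "r \<in> {RLt, RLe, REq, RGt}" for r
      using that \<open>x \<in> V\<close> \<open>y \<in> V\<close> unfolding sign_constraints_def by force
    then have "rel_holds r (A x - A y) 0 \<longrightarrow> rel_holds r (B x - B y) 0" if "r \<in> {RLt, RLe, REq, RGt}" for r
      using that assms unfolding sign_pattern_def by (fastforce simp: lval_def)
    from this[of RLt] this[of REq] this[of RGt] show ?thesis by auto
  qed
  then show "eq_literals B V = eq_literals A V" by (force simp: eq_literals_def)
  have "B x > 0 \<longleftrightarrow> A x > 0" if "x \<in> V" for x
  proof -
    have "LCon [(1, x)] r 0 \<in> sign_constraints V" if "r \<in> {RLt, RLe, REq, RGt}" for r
      using that \<open>x \<in> V\<close> unfolding sign_constraints_def by force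
    then have "rel_holds r (A x) 0 \<longrightarrow> rel_holds r (B x) 0" if "r \<in> {RLt, RLe, REq, RGt}" for r
      using that assms unfolding sign_pattern_def by (fastforce simp: lval_def)
    from this[of RLe] this[of RGt] show ?thesis by auto
  qed
  then show "sign_literals B V = sign_literals A V" by (force simp: sign_literals_def)
qed

lemma sats_std_literals:
  "sats std_Z A (eq_literals A V)" "sats std_Z A (sign_literals A V)"
  by (auto simp: sats_def eq_literals_def sign_literals_def std_Z_def)

text \<open>The values under \<open>\<sigma>\<close> may be nonstandard integers, but the truth
  values of finitely many constraints are always realised by genuine integers.\<close>

lemma sign_pattern_exists:
  assumes "interp theory_Z M \<sigma>" "sats M \<sigma> (lcons_forms C)" "finite C" "finite V"
  obtains A where "\<forall>c\<in>C. satisfies A c" "sats M \<sigma> (lcons_forms (sign_pattern V A))"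
proof -
  let ?K = "sign_constraints V"
  \<comment> \<open>Recording failed constraints as well makes \<open>A\<close> satisfy exactly the
    sign constraints that hold in \<open>M\<close>.\<close>
  let ?lit = "\<lambda>c. if sat M \<sigma> (lcon_form c) then lcon_form c else Neg (lcon_form c)"
  let ?\<Phi> = "lcons_forms C \<union> ?lit ` ?K"
  have 1: "finite ?\<Phi>" using assms(3,4) by (simp add: lcons_forms_def finite_sign_constraints)
  have 2: "wf_form sig_Z F \<and> quantifier_free F" if "F \<in> ?\<Phi>" for F
    using that wf_lcon_form by (auto simp: lcons_forms_def)
  have 3: "sats M \<sigma> ?\<Phi>" using assms(2) by (auto simp: sats_def)
  obtain A where A: "sats std_Z A ?\<Phi>" by (rule theory_Z_realizable[OF 1 2 assms(1) 3])
  have C: "\<forall>c\<in>C. satisfies A c" using A sats_std_lcons_forms[of A C] by (auto simp: sats_def)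
  have "sat M \<sigma> (lcon_form c)" if "c \<in> sign_pattern V A" for c
  proof (rule ccontr)
    assume "\<not> sat M \<sigma> (lcon_form c)"
    then have "Neg (lcon_form c) \<in> ?\<Phi>" using that by (force simp: sign_pattern_def)
    then have "sat std_Z A (Neg (lcon_form c))" using A unfolding sats_def by blast
    then have "\<not> satisfies A c" by (simp add: sat_std_lcon_form)
    then show False using that by (simp add: sign_pattern_def)
  qed
  then show ?thesis using C that by (auto simp: sats_def lcons_forms_def)
qed

text \<open>These are the side conditions of \<open>T_Learn\<close> for empty \<open>D\<close>, with
  an \<open>F\<close> that contradicts \<open>I\<close> and hence justifies learning any
  constraint.\<close>

definition refutable :: "signature \<Rightarrow> nat form set \<Rightarrow> 'v iatom set \<Rightarrow> 'v lcon set \<Rightarrow> bool" where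
  "refutable S T I C \<longleftrightarrow>
     (\<exists>F. wf_form (sig_union sig_Z S) F \<and> entails theory_Z (lcons_forms C) F \<and>
          \<not> consistent T (insert F (iatoms_forms I)))"

lemma bc_eliminate:
  assumes "finite Q" "\<And>C D. (C, D) \<in> Q \<Longrightarrow> D = {} \<and> (refutable S T I C \<or> \<not> (\<exists>B. \<forall>c\<in>C. satisfies B c))"
  shows "(bc_step S T I Ob lb)\<^sup>*\<^sup>* (Q, X) ({}, X)"
  using assms
proof (induction Q rule: finite_psubset_induct)
  case (psubset Q)
  show ?case
  proof (cases "Q = {}")
    case False
    then obtain C where CQ: "(C, {}) \<in> Q" using psubset.prems by fastforce
    define P where "P = Q - {(C, {})}"
    have Q: "Q = insert (C, {}) P" "(C, {}) \<notin> P" using CQ by (auto simp: P_def)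
    have IH: "(bc_step S T I Ob lb)\<^sup>*\<^sup>* (P', X) ({}, X)" if "P' \<subseteq> P" for P'
    proof (rule psubset.IH)
      show "P' \<subset> Q" using that Q by auto
      show "D' = {} \<and> (refutable S T I C' \<or> \<not> (\<exists>B. \<forall>c\<in>C'. satisfies B c))" if "(C', D') \<in> P'" for C' D'
        by (rule psubset.prems) (use that \<open>P' \<subseteq> P\<close> Q in blast)
    qed
    let ?c = "LCon [] RLt 0 :: 'a lcon"
    have c: "\<not> satisfies B ?c" for B by (simp add: lval_def)
    show ?thesis
    proof (cases "\<exists>B. \<forall>c\<in>C. satisfies B c")
      case False
      then have "bc_step S T I Ob lb (Q, X) (P, X)" unfolding Q(1) by (intro Drop Q(2)) simp
      then show ?thesis using IH[of P] by (simp add: converse_rtranclp_into_rtranclp)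
    next
      case True
      then obtain F where F: "wf_form (sig_union sig_Z S) F" "entails theory_Z (lcons_forms C) F"
          "\<not> consistent T (insert F (iatoms_forms I))"
        using psubset.prems[OF CQ] by (auto simp: refutable_def)
      \<comment> \<open>\<open>T_Learn\<close> requires a new constraint; a solvable
        \<open>C\<close> cannot contain \<open>0 < 0\<close>.\<close>
      have "?c \<notin> C" using True c by blast
      moreover have "entails T (insert F (iatoms_forms I)) (lcon_form ?c)"
        using F(3) by (auto simp: entails_def consistent_def sats_def)
      ultimately have 1: "bc_step S T I Ob lb (Q, X) (P \<union> {(insert ?c C, {})}, X)"
        unfolding Q(1) by (intro T_Learn[where F = F] Q(2) F(1)) (use F(2) in simp_all)
      \<comment> \<open>The extended subproblem may already belong to \<open>P\<close>. The two then
        coincide and \<open>Drop\<close> removes both, which is why the induction is over proper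
        subsets.\<close>
      let ?P = "P - {(insert ?c C, {})}"
      have "bc_step S T I Ob lb (insert (insert ?c C, {}) ?P, X) (?P, X)"
        by (rule Drop) (use c in auto)
      then have "bc_step S T I Ob lb (P \<union> {(insert ?c C, {})}, X) (?P, X)"
        by simp
      then show ?thesis using 1 IH[of ?P] by (meson Diff_subset converse_rtranclp_into_rtranclp)
    qed
  qed simp
qed

text \<open>The refuting formula is the conjunction of the literals of \<open>A\<close>. The pattern
  entails it, and were it consistent with \<open>I\<close>, then \<open>A\<close> itself would be a
  \<open>T\<close>-model.\<close>

lemma refutable_sign_pattern:
  assumes "is_theory S T" "sig_disjoint S sig_Z" "stably_infinite S T"
    and I: "finite I" "\<forall>i\<in>I. wf_iatom S i" and C: "finite C" "\<forall>c\<in>C. satisfies A c"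
    and "\<not> T_model T A C I"
  shows "refutable S T I (C \<union> sign_pattern (iatoms_vars I) A)"
proof -
  let ?V = "iatoms_vars I"
  let ?L = "eq_literals A ?V \<union> sign_literals A ?V"
  let ?C = "C \<union> sign_pattern ?V A"
  have fV: "finite ?V" using I(1) by (rule finite_iatoms_vars)
  then have "finite ?L" by (simp add: eq_literals_def sign_literals_def)
  from finite_list[OF this] obtain Fs where Fs: "set Fs = ?L" by blast
  \<comment> \<open>The signature is left open because the literals are needed both over
    \<open>sig_Z\<close> and over its union with \<open>S\<close>.\<close>
  have wf: "wf_form S' F \<and> quantifier_free F"
    if "F \<in> ?L" "Leq \<in> preds S'" "Num 0 \<in> funs S'" for F S'
    using that by (auto simp: eq_literals_def sign_literals_def)
  have "wf_form (sig_union sig_Z S) (Conj Fs)"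
    using wf by (auto simp: wf_form_Conj Fs sig_union_def sig_Z_def)
  moreover have "entails theory_Z (lcons_forms ?C) (Conj Fs)"
  proof -
    have "sat M \<sigma> (Conj Fs)" if "interp theory_Z M \<sigma>" "sats M \<sigma> (lcons_forms ?C)" for M \<sigma>
    proof (rule theory_Z_entailment[OF _ _ _ _ _ that])
      show "finite (lcons_forms ?C)"
        using C(1) finite_sign_constraints[OF fV] by (simp add: lcons_forms_def sign_pattern_def)
      show "wf_form sig_Z (Conj Fs)" "quantifier_free (Conj Fs)"
        using wf[of _ sig_Z] by (auto simp: wf_form_Conj quantifier_free_Conj Fs sig_Z_def)
      show "sat std_Z B (Conj Fs)" if "sats std_Z B (lcons_forms ?C)" for B
      proof -
        have "\<forall>c\<in>sign_pattern ?V A. satisfies B c"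
          using that by (auto simp: sats_std_lcons_forms)
        from sign_pattern_determines_literals[OF this] sats_std_literals[of B ?V]
        show ?thesis by (auto simp: sat_Conj Fs sats_def)
      qed
    qed (use wf_lcon_form in \<open>auto simp: lcons_forms_def\<close>)
    then show ?thesis by (auto simp: entails_def consistent_def sats_def)
  qed
  moreover have "\<not> consistent T (insert (Conj Fs) (iatoms_forms I))"
  proof
    assume "consistent T (insert (Conj Fs) (iatoms_forms I))"
    then have "consistent T (?L \<union> iatoms_forms I)"
      by (auto simp: consistent_def sats_def sat_Conj Fs)
    then show False using T_model_if_literals_consistent[OF assms(1-3) I C(2)] assms(8) by blast
  qed
  ultimately show ?thesis unfolding refutable_def by blast
qed

lemma bc_refutes_unsatisfiable:
  fixes C :: "'v lcon set"
  assumes "is_theory S T" "sig_disjoint S sig_Z" "stably_infinite S T"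
    and I: "finite I" "\<forall>i\<in>I. wf_iatom S i" and C: "finite C"
    and "\<nexists>A. T_model T A C I"
  shows "(bc_step S T I Ob lb)\<^sup>*\<^sup>* ({(C, {})}, NoSol) ({}, NoSol)"
proof -
  let ?V = "iatoms_vars I"
  \<comment> \<open>The two unsatisfiable sets ensure that there are at least two branches.\<close>
  let ?U = "{{LCon [] RLt 0}, {LCon [] RGt 0}} :: 'v lcon set set"
  define Cs where "Cs = ?U \<union> {C \<union> sign_pattern ?V A | A. \<forall>c\<in>C. satisfies A c}"
  have fK: "finite (sign_constraints ?V)"
    using I(1) by (intro finite_sign_constraints finite_iatoms_vars)
  \<comment> \<open>Even infinitely many solutions of \<open>C\<close> produce only finitely many
    patterns.\<close>
  have "Cs \<subseteq> ?U \<union> (\<union>) C ` Pow (sign_constraints ?V)"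
    by (auto simp: Cs_def sign_pattern_def)
  then have fin: "finite Cs" by (rule finite_subset) (use fK in simp)
  have "card ?U \<le> card Cs" by (rule card_mono[OF fin]) (simp add: Cs_def)
  then have card: "card Cs > 1" by simp
  have fin': "\<forall>C'\<in>Cs. finite C'"
    using C fK by (auto simp: Cs_def sign_pattern_def)
  have U: "\<not> satisfies B c" if "c \<in> {LCon [] RLt 0, LCon [] RGt 0}" for B :: "'v assignment" and c
    using that by (auto simp: lval_def)
  have equiv: "sats M \<sigma> (lcons_forms C) \<longleftrightarrow> (\<exists>C'\<in>Cs. sats M \<sigma> (lcons_forms C'))"
    if M: "interp theory_Z M \<sigma>" for M \<sigma>
  proof
    assume "sats M \<sigma> (lcons_forms C)"
    \<comment> \<open>\<open>Branch\<close> demands the equivalence in every model of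
      \<open>theory_Z\<close>, so the integer solutions must cover nonstandard models as
      well.\<close>
    from sign_pattern_exists[OF M this C finite_iatoms_vars[OF I(1)]]
    obtain A where "\<forall>c\<in>C. satisfies A c" "sats M \<sigma> (lcons_forms (sign_pattern ?V A))" by blast
    then show "\<exists>C'\<in>Cs. sats M \<sigma> (lcons_forms C')"
      using \<open>sats M \<sigma> (lcons_forms C)\<close>
      by (intro bexI[of _ "C \<union> sign_pattern ?V A"]) (auto simp: Cs_def sats_def lcons_forms_def)
  next
    assume "\<exists>C'\<in>Cs. sats M \<sigma> (lcons_forms C')"
    then obtain C' where C': "C' \<in> Cs" "sats M \<sigma> (lcons_forms C')" by blast
    have "C' \<notin> ?U"
    proof
      assume "C' \<in> ?U"
      then obtain c where c: "c \<in> C'" "c \<in> {LCon [] RLt 0, LCon [] RGt 0}" by blast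
      have "sat M \<sigma> (Neg (lcon_form c))"
        by (rule theory_Z_valid[OF _ _ _ M]) (use wf_lcon_form[of c] U[OF c(2)] in \<open>auto simp: sat_std_lcon_form\<close>)
      then show False using C'(2) c(1) by (auto simp: sats_def lcons_forms_def)
    qed
    then show "sats M \<sigma> (lcons_forms C)" using C' by (auto simp: Cs_def sats_def lcons_forms_def)
  qed
  have "bc_step S T I Ob lb (insert (C, {}) {}, NoSol) ({} \<union> {(C', {}) | C'. C' \<in> Cs}, NoSol)"
    by (rule Branch) (use fin card fin' equiv in auto)
  moreover have "(bc_step S T I Ob lb)\<^sup>*\<^sup>* ({(C', {}) | C'. C' \<in> Cs}, NoSol) ({}, NoSol)"
  proof (rule bc_eliminate)
    show "finite {(C', {}) | C'. C' \<in> Cs}" using fin by simp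
    fix C' D
    assume "(C', D) \<in> {(C', {}) | C'. C' \<in> Cs}"
    then have "D = {}" "C' \<in> Cs" by auto
    moreover have "refutable S T I C' \<or> \<not> (\<exists>B. \<forall>c\<in>C'. satisfies B c)"
    proof (cases "C' \<in> ?U")
      case True
      then show ?thesis using U by fastforce
    next
      case False
      then obtain A where "\<forall>c\<in>C. satisfies A c" "C' = C \<union> sign_pattern ?V A"
        using \<open>C' \<in> Cs\<close> by (auto simp: Cs_def)
      then show ?thesis using refutable_sign_pattern[OF assms(1-3) I C] assms(7) by blast
    qed
    ultimately show "D = {} \<and> (refutable S T I C' \<or> \<not> (\<exists>B. \<forall>c\<in>C'. satisfies B c))" by blast
  qed
  ultimately show ?thesis by (simp add: converse_rtranclp_into_rtranclp)
qed

section \<open>Completeness: no \<open>T\<close>-model, unbounded objective, or attained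
  minimum\<close>

theorem theorem5:
  fixes S :: signature
    and T :: "nat form set"
    and C :: "'v lcon set"
    and I :: "'v iatom set"
    and Ob :: "'v lexp"
    and lb :: "'v subproblem \<Rightarrow> ereal"
  assumes "is_theory S T"
    and "sig_disjoint S sig_Z"
    and "decidable_theory S T"
    and "stably_infinite S T"
    and "ilp_instance S C I Ob"
    and "lower_bound_fun Ob lb"
  shows "\<exists>A. (bc_step S T I Ob lb)\<^sup>*\<^sup>* ({(C, {})}, NoSol) ({}, A)"
proof (cases "\<exists>A. T_model T A C I")
  case False
  then show ?thesis
    using bc_refutes_unsatisfiable assms by (metis ilp_instance_def)
next
  case True
  then obtain A where A: "T_model T A C I" by blast
  show ?thesis
  proof (cases "\<forall>k :: int. \<exists>B. T_model T B C I \<and> lval B Ob < k")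
    case True
    \<comment> \<open>Any \<open>T\<close>-model can be the incumbent here, since the objective of
      \<open>NoSol\<close> is infinite.\<close>
    have "bc_step S T I Ob lb (insert (C, {}) {}, NoSol) ({}, SolInf A)"
      by (rule Unbounded) (use A True in simp_all)
    then show ?thesis by blast
  next
    case False
    then obtain k :: int where k: "\<And>B. T_model T B C I \<Longrightarrow> k \<le> lval B Ob" by (metis not_less)
    \<comment> \<open>Subtracting the lower bound \<open>k\<close> makes all objective values of
      \<open>T\<close>-models nonnegative, so passing to \<open>nat\<close> keeps their order and a
      least one exists.\<close>
    obtain A' where A': "T_model T A' C I"
        "\<forall>B. T_model T B C I \<longrightarrow> nat (lval A' Ob - k) \<le> nat (lval B Ob - k)"
      using ex_has_least_nat[of "\<lambda>A. T_model T A C I" A "\<lambda>A. nat (lval A Ob - k)"] A by blast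
    then have "lval A' Ob \<le> lval B Ob" if "T_model T B C I" for B
      using k[OF that] that by (fastforce simp: nat_le_eq_zle)
    then have "bc_step S T I Ob lb (insert (C, {}) {}, NoSol) ({}, Sol A')"
      by (intro Retire) (use A' in simp_all)
    then show ?thesis by blast
  qed
qed

end
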